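(* Let $G$ be a topological group, $\mathbb{K}\in\{\mathbb{R},\mathbb{C}\}$ and $d$ a positive integer. Every partial cotranslation $W:G\times G\to\mathcal{M}_d(\mathbb{K})$ is conjugated to a partial cotranslation $\widehat{W}:G\times G\to\mathcal{M}_d(\mathbb{K})$ whose projector of the units space is constant and orthogonal, i.e. $$\widehat{W}(g,e)=\begin{pmatrix}\mathrm{Id}_{\operatorname{rank}W}&0\\0&0\end{pmatrix},\qquad\forall\,g\in G,$$ where $\mathrm{Id}_{\operatorname{rank}W}$ is the identity on $\mathbb{K}^{\operatorname{rank}W}$.
   Context: $e$ is the unit of $G$; $\mathcal{M}_d(\mathbb{K})$ is the algebra of $d\times d$ matrices, $GL_d(\mathbb{K})$ its group of invertible elements. A function $W:G\times G\to\mathcal{M}_d(\mathbb{K})$ is a partial cotranslation if $W(g,kh)=W(hg,k)W(g,h)$ for all $g,h,k\in G$. For such $W$, the rank of $W(g,h)$ does not depend on $(g,h)$; this common value is denoted $\operatorname{rank}W$. The projector of the units space of $W$ is the map $g\mapsto W(g,e)$. Two partial cotranslations $W,V$ are conjugated if there is a map $T:G\to GL_d(\mathbb{K})$ such that $T(hg)V(g,h)=W(g,h)T(g)$ for all $g,h\in G$. *)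

theory Defs
  imports Complex_Main "Jordan_Normal_Form.DL_Rank"
begin

text \<open>
  The (not necessarily commutative) topological group \<open>G\<close> is the library class
  \<^class>\<open>topological_group_add\<close>, hence written additively: the product \<open>hg\<close> becomes \<open>h + g\<close>
  and the unit \<open>e\<close> becomes \<open>0\<close>. No continuity of \<open>W\<close> or of the conjugating map is required.
\<close>

definition partial_cotranslation ::
    "nat \<Rightarrow> ('g::topological_group_add \<Rightarrow> 'g \<Rightarrow> 'k::field mat) \<Rightarrow> bool" where
  "partial_cotranslation d W \<longleftrightarrow>
     (\<forall>g h. W g h \<in> carrier_mat d d) \<and>
     (\<forall>g h k. W g (k + h) = W (h + g) k * W g h)"

text \<open>The common value of the ranks of the matrices \<open>W g h\<close>; meaningful because the rank of
  \<open>W g h\<close> does not depend on \<open>(g, h)\<close> when \<open>W\<close> is a partial cotranslation.\<close>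

definition cotranslation_rank ::
    "nat \<Rightarrow> ('g \<Rightarrow> 'g \<Rightarrow> 'k::field mat) \<Rightarrow> nat" where
  "cotranslation_rank d W = (THE r. \<forall>g h. vec_space.rank d (W g h) = r)"

definition units_projector ::
    "('g::topological_group_add \<Rightarrow> 'g \<Rightarrow> 'k mat) \<Rightarrow> 'g \<Rightarrow> 'k mat" where
  "units_projector W g = W g 0"

definition GL :: "nat \<Rightarrow> 'k::field mat set" where
  "GL d = {A \<in> carrier_mat d d. invertible_mat A}"

definition conjugated ::
    "nat \<Rightarrow> ('g::topological_group_add \<Rightarrow> 'g \<Rightarrow> 'k::field mat) \<Rightarrow> ('g \<Rightarrow> 'g \<Rightarrow> 'k mat) \<Rightarrow> bool" where
  "conjugated d W V \<longleftrightarrow>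
     (\<exists>T. (\<forall>g. T g \<in> GL d) \<and> (\<forall>g h. T (h + g) * V g h = W g h * T g))"

end

theory Submission
  imports Defs
begin

text \<open>
  The cotranslation identity with \<open>h = k = e\<close> shows that \<open>W g e\<close> is idempotent, hence similar to
  the block projector of its rank: maximal independent sets of columns of \<open>P = W g e\<close> and of
  \<open>1 - P\<close> consist of eigenvectors of \<open>P\<close> for the eigenvalues 1 and 0, and together form a basis.
  Choosing such a basis matrix \<open>S g\<close> for every \<open>g\<close> independently, \<open>S\<close> itself is the conjugation.
  The rank does not depend on \<open>g\<close> because \<open>W g h\<close> divides \<open>W g e\<close> on the right and is divided by it,
  and every \<open>W g e\<close> factors as \<open>W b k\<close> times another value of \<open>W\<close>.
\<close>

section \<open>Ranks of matrix products and independent columns\<close>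

lemma in_set_colsE:
  assumes "x \<in> set (cols A)" and "A \<in> carrier_mat n k"
  obtains j where "j < k" "x = col A j"
  using assms by (auto simp: cols_def)

text \<open>Each column of \<open>A * B\<close> is \<open>A\<close> applied to a column of
  \<open>B\<close>, hence a combination of the columns of \<open>A\<close>. The column spaces are
  therefore nested, and dimension is monotone on subspaces.\<close>

lemma (in vec_space) rank_mult_le_left:
  assumes A: "A \<in> carrier_mat n m" and B: "B \<in> carrier_mat m k"
  shows "rank (A * B) \<le> rank A"
proof -
  let ?W = "span (set (cols A))" and ?X = "span (set (cols (A * B)))"
  have AB: "A * B \<in> carrier_mat n k" using A B by simp
  have cA: "set (cols A) \<subseteq> carrier_vec n" using A cols_dim by blast
  have cAB: "set (cols (A * B)) \<subseteq> carrier_vec n" using AB cols_dim by blast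
  have "set (cols (A * B)) \<subseteq> ?W"
  proof
    fix x assume "x \<in> set (cols (A * B))"
    then obtain j where j: "j < k" and x: "x = col (A * B) j"
      using AB by (rule in_set_colsE)
    have "x = A *\<^sub>v col B j" using col_mult2[OF A B j] x by simp
    also have "\<dots> = mat_of_cols n (cols A) *\<^sub>v col B j" using A mat_of_cols_cols[of A] by simp
    also have "\<dots> \<in> ?W"
      by (subst mat_of_cols_mult_as_finsum) (use A B j cA in \<open>auto simp: in_spanI\<close>)
    finally show "x \<in> ?W" .
  qed
  then have XW: "?X \<subseteq> ?W" using cA span_subsetI by blast
  have W: "subspace class_ring ?W V" and X: "subspace class_ring ?X V"
    using cA cAB span_is_subspace by auto
  show ?thesis
    unfolding rank_def
    using vectorspace.subspace_dim[OF subspace_is_vs[OF W] nested_subspaces[OF W X XW]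
        fin_dim_span_cols[OF A]] fin_dim_span_cols[OF AB] by auto
qed

text \<open>Any maximal independent set of columns has as many elements as the rank. It is returned
  as a distinct list so that it can serve as the columns of a matrix.\<close>

lemma maximal_lin_indpt_cols:
  fixes A :: "'a::field mat"
  assumes A: "A \<in> carrier_mat n k"
  obtains us where "set us \<subseteq> set (cols A)" "distinct us"
    "\<not> module.lin_dep class_ring (module_vec TYPE('a) n) (set us)"
    "length us = vec_space.rank n A"
proof -
  interpret vec_space "TYPE('a)" n .
  have "lin_indpt {}" by (auto simp: lin_dep_def)
  then obtain S where S: "maximal S (\<lambda>T. T \<subseteq> set (cols A) \<and> lin_indpt T)"
    using maximal_exists_superset[of "set (cols A)" "\<lambda>T. T \<subseteq> set (cols A) \<and> lin_indpt T" "{}"]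
    by auto
  then have sub: "S \<subseteq> set (cols A)" "lin_indpt S" by (auto simp: maximal_def)
  then obtain us where "set us = S" "distinct us"
    using finite_distinct_list finite_subset by blast
  with that sub rank_card_indpt[OF A S] show ?thesis
    by (metis distinct_card)
qed

text \<open>Independent columns of \<open>A * B\<close> lift to equally many independent columns of
  \<open>B\<close>, since \<open>A\<close> carries a linear relation among the lifts to one among
  their images.\<close>

lemma rank_mult_le_right:
  fixes A B :: "'a::field mat"
  assumes A: "A \<in> carrier_mat n m" and B: "B \<in> carrier_mat m k"
  shows "vec_space.rank n (A * B) \<le> vec_space.rank m B"
proof -
  interpret N: vec_space "TYPE('a)" n .
  interpret M: vec_space "TYPE('a)" m .
  have AB: "A * B \<in> carrier_mat n k" using A B by simp
  obtain us where us: "set us \<subseteq> set (cols (A * B))" "distinct us" "N.lin_indpt (set us)"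
    "length us = N.rank (A * B)"
    using maximal_lin_indpt_cols[OF AB] by blast
  have "\<forall>u \<in> set us. \<exists>w \<in> set (cols B). u = A *\<^sub>v w"
  proof
    fix u assume "u \<in> set us"
    then obtain j where "j < k" "u = col (A * B) j"
      using us(1) AB by (meson in_set_colsE subsetD)
    then show "\<exists>w \<in> set (cols B). u = A *\<^sub>v w"
      using B col_mult2[OF A B] by (intro bexI[of _ "col B j"]) (auto simp: cols_def)
  qed
  then obtain f where f: "\<And>u. u \<in> set us \<Longrightarrow> f u \<in> set (cols B) \<and> u = A *\<^sub>v f u"
    by metis
  let ?r = "length us"
  define C where "C = mat_of_cols m (map f us)"
  have fB: "set (map f us) \<subseteq> set (cols B)" using f by auto
  then have fm: "set (map f us) \<subseteq> carrier_vec m" using B cols_dim by blast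
  have C: "C \<in> carrier_mat m ?r" and colsC: "cols C = map f us"
    using fm by (auto simp: C_def)
  have usn: "set us \<subseteq> carrier_vec n" using us(1) AB cols_dim by blast
  have AC: "A * C = mat_of_cols n us"
  proof (rule mat_col_eqI)
    fix i assume "i < dim_col (mat_of_cols n us)"
    then have i: "i < ?r" by simp
    have "col C i = f (us ! i)"
      using i fm unfolding C_def by (subst col_mat_of_cols) auto
    moreover have "col (mat_of_cols n us) i = us ! i"
      using i usn by (subst col_mat_of_cols) auto
    ultimately show "col (A * C) i = col (mat_of_cols n us) i"
      using i col_mult2[OF A C i] f[of "us ! i"] by simp
  qed (use A C in auto)
  have colsAC: "cols (A * C) = us" using AC usn by simp
  \<comment> \<open>Multiplication by \<open>A\<close> is a left inverse of \<open>f\<close> on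
    \<open>us\<close>, so \<open>f\<close> is injective there.\<close>
  have distf: "distinct (map f us)"
    using us(2) f by (metis distinct_map inj_onI)
  have "M.lin_indpt (set (map f us))"
  proof
    assume "M.lin_dep (set (map f us))"
    then obtain v where v: "v \<in> carrier_vec ?r" "v \<noteq> 0\<^sub>v ?r" "C *\<^sub>v v = 0\<^sub>v m"
      using M.lin_depE[OF C] distf colsC by metis
    \<comment> \<open>A nonzero kernel vector of \<open>C\<close> is one of \<open>A * C\<close>
      too, and the columns of that matrix are \<open>us\<close>.\<close>
    have "(A * C) *\<^sub>v v = 0\<^sub>v n"
      using assoc_mult_mat_vec[OF A C v(1)] v(3) A by auto
    then have "N.lin_dep (set us)"
      using N.lin_depI[of "A * C" ?r v] A C v us(2) colsAC by simp
    then show False using us(3) by simp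
  qed
  then have "card (set (map f us)) \<le> M.rank B"
    using M.rank_ge_card_indpt[OF B fB] by simp
  then show ?thesis using us(4) distinct_card[OF distf] by simp
qed

section \<open>Eigenvectors and the normal form of an idempotent matrix\<close>

lemma (in vec_space) eigen_lincomb:
  assumes A: "A \<in> carrier_mat n n" and U: "finite U" "U \<subseteq> carrier_vec n"
    and eig: "\<And>u. u \<in> U \<Longrightarrow> A *\<^sub>v u = c \<cdot>\<^sub>v u"
  shows "A *\<^sub>v lincomb a U = c \<cdot>\<^sub>v lincomb a U"
proof -
  obtain us where us: "set us = U" "distinct us" using U finite_distinct_list by blast
  let ?C = "mat_of_cols n us" and ?r = "length us"
  have C: "?C \<in> carrier_mat n ?r" and colsC: "cols ?C = us" using us U by auto
  \<comment> \<open>With the eigenvectors as columns, the eigenvalue equations become one matrix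
    identity; applying it to the coefficient vector \<open>w\<close> below yields the claim.\<close>
  have AC: "A * ?C = c \<cdot>\<^sub>m ?C"
  proof (rule mat_col_eqI)
    fix i assume "i < dim_col (c \<cdot>\<^sub>m ?C)"
    then have i: "i < ?r" by simp
    moreover from i have "us ! i \<in> U" using us nth_mem by blast
    moreover have "col ?C i = us ! i" using i us U by (subst col_mat_of_cols) auto
    ultimately show "col (A * ?C) i = col (c \<cdot>\<^sub>m ?C) i"
      using i col_mult2[OF A C i] eig by simp
  qed (use A in auto)
  define w where "w = vec ?r (\<lambda>i. a (col ?C i))"
  have w: "w \<in> carrier_vec ?r" by (simp add: w_def)
  have lc: "lincomb a U = ?C *\<^sub>v w"
    using mat_mult_eq_lincomb[OF C, of a] colsC us unfolding w_def by simp
  have "A *\<^sub>v (?C *\<^sub>v w) = (c \<cdot>\<^sub>m ?C) *\<^sub>v w"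
    using A C w AC by (simp flip: assoc_mult_mat_vec[of _ n n _ ?r])
  also have "\<dots> = c \<cdot>\<^sub>v (?C *\<^sub>v w)" using C w by auto
  finally show ?thesis using lc by simp
qed

text \<open>The inverse \<open>R\<close> of \<open>S\<close> is returned with both of its
  identities, so that conjugates can later be written as plain products.\<close>

lemma idempotent_similar_block:
  fixes P :: "'a::field mat"
  assumes P: "P \<in> carrier_mat d d" and idem: "P * P = P"
  defines "r \<equiv> vec_space.rank d P"
  obtains S R where "S \<in> carrier_mat d d" "R \<in> carrier_mat d d" "S * R = 1\<^sub>m d" "R * S = 1\<^sub>m d"
    "R * P * S = four_block_mat (1\<^sub>m r) (0\<^sub>m r (d - r)) (0\<^sub>m (d - r) r) (0\<^sub>m (d - r) (d - r))"
proof -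
  interpret vec_space "TYPE('a)" d .
  \<comment> \<open>The complementary projector: \<open>P * Q = 0\<close> places its columns in the
    kernel of \<open>P\<close>.\<close>
  define Q where "Q = 1\<^sub>m d - P"
  have Q: "Q \<in> carrier_mat d d" using P unfolding Q_def by (intro minus_carrier_mat)
  have PQ: "P * Q = 0\<^sub>m d d"
    unfolding Q_def using P idem by (subst mult_minus_distrib_mat[of _ d d]) auto
  obtain us where us: "set us \<subseteq> set (cols P)" "distinct us" "lin_indpt (set us)" "length us = rank P"
    using maximal_lin_indpt_cols[OF P] by blast
  obtain ws where ws: "set ws \<subseteq> set (cols Q)" "distinct ws" "lin_indpt (set ws)" "length ws = rank Q"
    using maximal_lin_indpt_cols[OF Q] by blast
  have usd: "set us \<subseteq> carrier_vec d" using us(1) P cols_dim by blast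
  have wsd: "set ws \<subseteq> carrier_vec d" using ws(1) Q cols_dim by blast
  have Pu: "P *\<^sub>v u = 1 \<cdot>\<^sub>v u" if u: "u \<in> set us" for u
  proof -
    obtain j where j: "j < d" "u = col P j" using u us(1) P by (meson in_set_colsE subsetD)
    have "P *\<^sub>v u = col (P * P) j" using j col_mult2[OF P P] by simp
    then show ?thesis using j idem by simp
  qed
  have Pw: "P *\<^sub>v w = 0 \<cdot>\<^sub>v w" if w: "w \<in> set ws" for w
  proof -
    obtain j where j: "j < d" "w = col Q j" using w ws(1) Q by (meson in_set_colsE subsetD)
    have "P *\<^sub>v w = col (P * Q) j" using j col_mult2[OF P Q] by simp
    then show ?thesis using j Q PQ by auto
  qed
  \<comment> \<open>A common vector would satisfy \<open>x = P x = 0\<close>, but an independent set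
    cannot contain zero. Disjointness is used to split combinations over the union and to keep
    \<open>bs\<close> distinct.\<close>
  have disj: "set us \<inter> set ws = {}"
  proof (rule ccontr)
    assume "set us \<inter> set ws \<noteq> {}"
    then obtain x where x: "x \<in> set us" "x \<in> set ws" by blast
    then have xd: "x \<in> carrier_vec d" using usd by blast
    have "x = 0\<^sub>v d" using Pu[OF x(1)] Pw[OF x(2)] xd by auto
    then show False using x(1) us(3) vs_zero_lin_dep[of "set us"] usd by auto
  qed
  have indpt: "lin_indpt (set us \<union> set ws)"
  proof (rule finite_lin_indpt2)
    fix a :: "'a vec \<Rightarrow> 'a" assume "lincomb a (set us \<union> set ws) = 0\<^sub>v d"
    then have sum0: "lincomb a (set us) + lincomb a (set ws) = 0\<^sub>v d"
      using lincomb_union[OF usd wsd disj] by auto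
    let ?x = "lincomb a (set us)" and ?y = "lincomb a (set ws)"
    have x: "?x \<in> carrier_vec d" and y: "?y \<in> carrier_vec d" using usd wsd by auto
    \<comment> \<open>Applying \<open>P\<close> to the relation \<open>?x + ?y = 0\<close> keeps
      \<open>?x\<close> and kills \<open>?y\<close>, so both parts vanish separately.\<close>
    have "P *\<^sub>v ?x = 1 \<cdot>\<^sub>v ?x" by (rule eigen_lincomb[OF P _ usd]) (use Pu in auto)
    moreover have "P *\<^sub>v ?y = 0 \<cdot>\<^sub>v ?y" by (rule eigen_lincomb[OF P _ wsd]) (use Pw in auto)
    moreover have "P *\<^sub>v ?x + P *\<^sub>v ?y = P *\<^sub>v 0\<^sub>v d"
      using sum0 P x y by (metis mult_add_distrib_mat_vec)
    ultimately have x0: "?x = 0\<^sub>v d" using P x y by auto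
    with sum0 y have y0: "?y = 0\<^sub>v d" by auto
    have "a u = 0" if "u \<in> set us" for u
      using that us(3) x0 usd by (meson List.finite_set UNIV_I lin_dep_def order_refl Pi_I)
    moreover have "a w = 0" if "w \<in> set ws" for w
      using that ws(3) y0 wsd by (meson List.finite_set UNIV_I lin_dep_def order_refl Pi_I)
    ultimately show "\<forall>v\<in>set us \<union> set ws. a v = 0" by blast
  qed (use usd wsd in auto)
  define bs where "bs = us @ ws"
  have bs: "set bs \<subseteq> carrier_vec d" "distinct bs" "lin_indpt (set bs)"
    using usd wsd us(2) ws(2) disj indpt by (auto simp: bs_def)
  have "length bs \<le> d"
    using li_le_dim(2)[OF fin_dim, of "set bs"] bs dim_is_n distinct_card[OF bs(2)] by auto
  \<comment> \<open>Subadditivity of rank on \<open>P + Q = 1\<close> shows that the two families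
    together are numerous enough to form a basis.\<close>
  moreover have "d \<le> length bs"
  proof -
    have "P + Q = 1\<^sub>m d" using P by (auto simp: Q_def)
    moreover have "rank (1\<^sub>m d :: 'a mat) = d" by (rule low_rank_det_zero) auto
    ultimately have "d \<le> rank P + rank Q" using rank_subadditive[OF P Q] by simp
    then show ?thesis using us(4) ws(4) by (simp add: bs_def)
  qed
  ultimately have len: "length bs = d" by simp
  define S where "S = mat_of_cols d bs"
  have S: "S \<in> carrier_mat d d" and colsS: "cols S = bs" using bs len by (auto simp: S_def)
  have "det S \<noteq> 0"
    using det_rank_iff[OF S] lin_indpt_full_rank[OF S] colsS bs by simp
  then obtain R where R: "R \<in> carrier_mat d d" "S * R = 1\<^sub>m d" "R * S = 1\<^sub>m d"
    using det_non_zero_imp_unit[OF S] S by (auto simp: Units_def ring_mat_def)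
  have rd: "r \<le> d" and lenus: "length us = r" using us(4) len by (auto simp: r_def bs_def)
  let ?D = "four_block_mat (1\<^sub>m r) (0\<^sub>m r (d - r)) (0\<^sub>m (d - r) r) (0\<^sub>m (d - r) (d - r)) :: 'a mat"
  have D: "?D \<in> carrier_mat d d" using rd by auto
  \<comment> \<open>Compared column by column: listing \<open>us\<close> before \<open>ws\<close>
    makes the first \<open>r\<close> columns fixed by \<open>P\<close> and the remaining ones
    annihilated, just as \<open>?D\<close> prescribes.\<close>
  have "P * S = S * ?D"
  proof (rule mat_col_eqI)
    fix j assume "j < dim_col (S * ?D)"
    then have j: "j < d" using rd by simp
    have cS: "col S j = bs ! j" using j bs len unfolding S_def by (subst col_mat_of_cols) auto
    have bj: "bs ! j \<in> carrier_vec d" using j bs len nth_mem by blast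
    have L: "col (P * S) j = P *\<^sub>v (bs ! j)" using col_mult2[OF P S j] cS by simp
    have Rr: "col (S * ?D) j = S *\<^sub>v col ?D j" using col_mult2[OF S D j] .
    have Su: "S *\<^sub>v unit_vec d j = bs ! j"
      using col_mult2[OF S one_carrier_mat j] cS S j by simp
    show "col (P * S) j = col (S * ?D) j"
    proof (cases "j < r")
      case True
      then have "bs ! j \<in> set us" using lenus by (simp add: bs_def nth_append)
      moreover have "col ?D j = unit_vec d j" using True rd by (intro eq_vecI) auto
      ultimately show ?thesis using L Rr Pu bj Su by simp
    next
      case False
      then have "bs ! j \<in> set ws" using lenus j len by (auto simp: bs_def nth_append)
      moreover have "col ?D j = 0\<^sub>v d" using False rd j by (intro eq_vecI) auto
      ultimately show ?thesis using L Rr Pw bj S by auto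
    qed
  qed (use P S rd in auto)
  then have "R * P * S = (R * S) * ?D"
    using assoc_mult_mat[OF R(1) P S] assoc_mult_mat[OF R(1) S D] by simp
  then have "R * P * S = ?D" using R(3) left_mult_one_mat[OF D] by simp
  with that S R show ?thesis by blast
qed

section \<open>Rank and conjugation of partial cotranslations\<close>

lemma cotranslation_rank_eq:
  fixes W :: "'g::topological_group_add \<Rightarrow> 'g \<Rightarrow> 'k::field mat"
  assumes "partial_cotranslation d W"
  shows "cotranslation_rank d W = vec_space.rank d (W g 0)"
proof -
  have W: "W a b \<in> carrier_mat d d" and cot: "W a (k + h) = W (h + a) k * W a h" for a b h k
    using assms by (auto simp: partial_cotranslation_def)
  let ?rk = "vec_space.rank d"
  have le_l: "?rk (X * Y) \<le> ?rk X" and le_r: "?rk (X * Y) \<le> ?rk Y"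
    if "X \<in> carrier_mat d d" "Y \<in> carrier_mat d d" for X Y :: "'k mat"
    using that vec_space.rank_mult_le_left rank_mult_le_right by blast+
  \<comment> \<open>Each of the two matrices is a right factor of the other:
    \<open>h = h + 0\<close> gives one factorization, \<open>0 = - h + h\<close> the other.\<close>
  have fwd: "?rk (W a h) = ?rk (W a 0)" for a h
  proof (rule antisym)
    show "?rk (W a h) \<le> ?rk (W a 0)"
      using cot[of a h 0] le_r[OF W W] by (metis add.left_neutral add.right_neutral)
    show "?rk (W a 0) \<le> ?rk (W a h)"
      using cot[of a "- h" h] le_r[OF W W] by (metis left_minus)
  qed
  have base_le: "?rk (W a 0) \<le> ?rk (W b 0)" for a b
  proof -
    \<comment> \<open>Going from \<open>a\<close> to \<open>b\<close> by \<open>b - a\<close> and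
      back by \<open>a - b\<close> exhibits a value of \<open>W\<close> at base point
      \<open>b\<close> as a left factor.\<close>
    have "W a 0 = W b (a - b) * W a (b - a)"
      using cot[of a "a - b" "b - a"] by (simp add: add_diff_eq)
    then show ?thesis using le_l[OF W W] fwd by metis
  qed
  \<comment> \<open>This is what makes the definite description denote. As \<open>g\<close> is
    arbitrary, the same block size serves every base point.\<close>
  have "?rk (W a h) = ?rk (W g 0)" for a h
    using fwd base_le by (metis antisym)
  then show ?thesis unfolding cotranslation_rank_def by (intro the_equality) auto
qed

text \<open>The argument is purely algebraic and works over any field, so the real and the complex
  case are both instances.\<close>

lemma conjugated_to_block_projector:
  fixes W :: "'g::topological_group_add \<Rightarrow> 'g \<Rightarrow> 'k::field mat"
  assumes pc: "partial_cotranslation d W"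
  shows "\<exists>W'. partial_cotranslation d W' \<and> conjugated d W W' \<and>
    (let r = cotranslation_rank d W in
      \<forall>g. units_projector W' g =
        four_block_mat (1\<^sub>m r) (0\<^sub>m r (d - r)) (0\<^sub>m (d - r) r) (0\<^sub>m (d - r) (d - r)))"
proof -
  have W: "W a b \<in> carrier_mat d d" and cot: "W a (k + h) = W (h + a) k * W a h" for a b h k
    using pc by (auto simp: partial_cotranslation_def)
  define r where "r = cotranslation_rank d W"
  let ?D = "four_block_mat (1\<^sub>m r) (0\<^sub>m r (d - r)) (0\<^sub>m (d - r) r) (0\<^sub>m (d - r) (d - r)) :: 'k mat"
  have "\<exists>S R. S \<in> carrier_mat d d \<and> R \<in> carrier_mat d d \<and> S * R = 1\<^sub>m d \<and> R * S = 1\<^sub>m d \<and>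
    R * W g 0 * S = ?D" for g
  proof -
    have "W g 0 * W g 0 = W g 0" using cot[of g 0 0] by simp
    from idempotent_similar_block[OF W this] show ?thesis
      unfolding r_def cotranslation_rank_eq[OF pc, of g] by blast
  qed
  then obtain S R where S: "\<And>g. S g \<in> carrier_mat d d" and R: "\<And>g. R g \<in> carrier_mat d d"
    and SR: "\<And>g. S g * R g = 1\<^sub>m d" and RS: "\<And>g. R g * S g = 1\<^sub>m d"
    and D: "\<And>g. R g * W g 0 * S g = ?D"
    by metis
  note carr = S R W mult_carrier_mat[of _ d d _ d]
  \<comment> \<open>This solves the conjugation equation with \<open>T = S\<close> for the second
    cotranslation; the inverse is taken at the end point \<open>h + g\<close>.\<close>
  define W' where "W' g h = R (h + g) * W g h * S g" for g h
  have SW': "S (h + g) * W' g h = W g h * S g" for g h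
  proof -
    have "S (h + g) * W' g h = (S (h + g) * R (h + g)) * (W g h * S g)"
      unfolding W'_def by (simp add: assoc_mult_mat[of _ d d _ d _ d] carr)
    then show ?thesis using SR by (simp add: left_mult_one_mat[of _ d d] carr)
  qed
  have "W' g (k + h) = W' (h + g) k * W' g h" for g h k
  proof -
    \<comment> \<open>The intermediate \<open>S (h + g)\<close> is absorbed by \<open>SW'\<close>,
      which leaves the cotranslation identity of \<open>W\<close> between the outer factors.\<close>
    have "W' (h + g) k * W' g h = R (k + (h + g)) * W (h + g) k * (S (h + g) * W' g h)"
      unfolding W'_def by (simp add: assoc_mult_mat[of _ d d _ d _ d] carr)
    also have "\<dots> = R (k + (h + g)) * (W (h + g) k * W g h) * S g"
      unfolding SW' by (simp add: assoc_mult_mat[of _ d d _ d _ d] carr)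
    finally show ?thesis by (simp add: W'_def cot add.assoc)
  qed
  moreover have "W' g h \<in> carrier_mat d d" for g h
    unfolding W'_def using S R W by (meson mult_carrier_mat)
  ultimately have "partial_cotranslation d W'" by (simp add: partial_cotranslation_def)
  moreover have "S g \<in> GL d" for g
    using S[of g] R[of g] SR[of g] RS[of g]
    by (auto simp: GL_def invertible_mat_def inverts_mat_def)
  then have "conjugated d W W'" unfolding conjugated_def using SW' by blast
  \<comment> \<open>At the unit the end point \<open>0 + g\<close> is \<open>g\<close> itself, so
    \<open>W' g 0\<close> is a genuine similarity transform of \<open>W g 0\<close>.\<close>
  moreover have "units_projector W' g = ?D" for g
    using D by (simp add: units_projector_def W'_def)
  ultimately show ?thesis unfolding r_def Let_def by blast
qed

theorem proposition5p16:
  fixes d :: nat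
  assumes "d > 0"
  shows
    "(\<forall>W :: 'g::topological_group_add \<Rightarrow> 'g \<Rightarrow> real mat.
        partial_cotranslation d W \<longrightarrow>
        (\<exists>W'. partial_cotranslation d W' \<and> conjugated d W W' \<and>
           (let r = cotranslation_rank d W in
             \<forall>g. units_projector W' g =
               four_block_mat (1\<^sub>m r) (0\<^sub>m r (d - r)) (0\<^sub>m (d - r) r) (0\<^sub>m (d - r) (d - r))))) \<and>
     (\<forall>W :: 'g \<Rightarrow> 'g \<Rightarrow> complex mat.
        partial_cotranslation d W \<longrightarrow>
        (\<exists>W'. partial_cotranslation d W' \<and> conjugated d W W' \<and>
           (let r = cotranslation_rank d W in
             \<forall>g. units_projector W' g =
               four_block_mat (1\<^sub>m r) (0\<^sub>m r (d - r)) (0\<^sub>m (d - r) r) (0\<^sub>m (d - r) (d - r)))))"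
  by (intro conjI allI impI conjugated_to_block_projector)

end
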